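(* Let $d>2$ be an integer. Then, for any $p=2,\dots,d-1$, $$\frac{\mathbb{E}_{\mathtt{mb}}[p,d]}{p+1}>\frac{\mathbb{E}_{\mathtt{mb}}[p+1,d]}{p+2}.$$
   Context: Let $1\le p\le d$ be integers. $\mathcal{S}^{d-1}$ is the Euclidean unit sphere in $\mathbb{R}^d$, and $\mathcal{V}_{p,d}=\{X\in\mathbb{R}^{d\times p}: X^{\mathrm T}X=I_p\}$ is the Stiefel manifold with its uniform distribution (the unique probability measure invariant under left multiplication by orthogonal $d\times d$ matrices). Let $g$ be uniformly distributed on $\mathcal{S}^{d-1}$ and let $B=[b_1\ \cdots\ b_p]$ be uniformly distributed on $\mathcal{V}_{p,d}$, with $g$ and $B$ independent. Put $f^{lin}(x)=g^{\mathrm T}x$. One model-based iteration in the random subspace, from a current iterate $x^k\in\mathbb{R}^d$ and with trust-region radius $\delta=1$, does the following. Let $f|_p(z)=f^{lin}(x^k+\sum_{i=1}^p z_ib_i)$ for $z\in\mathbb{R}^p$, and let $e_1,\dots,e_p$ be the canonical basis of $\mathbb{R}^p$. Form the simplex gradient $s\in\mathbb{R}^p$ of $f|_p$ at $0$, i.e. $s_i=f|_p(e_i)-f|_p(0)$ for $i=1,\dots,p$, and put $u=-s/\|s\|$ (Euclidean norm; $s\ne 0$ almost surely, and if $s=0$ one takes $x^{k+1}=x^k$). Let $z^*\in\{0,u\}$ be a minimizer of $f|_p$ over $\{0,u\}$ and set $x^{k+1}=x^k+\sum_{i=1}^p z_i^*b_i$. The expected decrease is $\mathbb{E}_{\mathtt{mb}}[p,d]:=\mathbb{E}[f^{lin}(x^k)-f^{lin}(x^{k+1})]$,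 the expectation being over $g$ and $B$. (For $p\ge2$ the iteration evaluates the function at $p+1$ new points, so $\mathbb{E}_{\mathtt{mb}}[p,d]/(p+1)$ is the expected decrease per function evaluation.) *)

theory Defs
  imports "HOL-Probability.Probability"
begin

text \<open>
  A \<open>d \<times> p\<close> matrix is an element of \<open>real ^ 'p ^ 'd\<close>, with \<open>d = CARD('d)\<close> and \<open>p = CARD('p)\<close>;
  its columns are \<open>column i B\<close> for \<open>i :: 'p\<close>.
\<close>

definition stiefel :: "(real ^ 'p ^ 'd) set" where
  "stiefel = {X. transpose X ** X = mat 1}"

text \<open>
  The uniform distributions on the sphere and on the Stiefel manifold are represented as Borel
  probability measures on the ambient space that are concentrated on the manifold and invariant
  under (left multiplication by) orthogonal \<open>d \<times> d\<close> matrices.  On either manifold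
  (for \<open>p \<le> d\<close>) there is exactly one such measure.
\<close>

definition uniform_on_sphere :: "(real ^ 'd) measure \<Rightarrow> bool" where
  "uniform_on_sphere \<sigma> \<longleftrightarrow>
     prob_space \<sigma> \<and> sets \<sigma> = sets borel \<and> (AE g in \<sigma>. g \<in> sphere 0 1) \<and>
     (\<forall>Q :: real ^ 'd ^ 'd. orthogonal_matrix Q \<longrightarrow> distr \<sigma> borel (\<lambda>g. Q *v g) = \<sigma>)"

definition uniform_on_stiefel :: "(real ^ 'p ^ 'd) measure \<Rightarrow> bool" where
  "uniform_on_stiefel \<mu> \<longleftrightarrow>
     prob_space \<mu> \<and> sets \<mu> = sets borel \<and> (AE B in \<mu>. B \<in> stiefel) \<and>
     (\<forall>Q :: real ^ 'd ^ 'd. orthogonal_matrix Q \<longrightarrow> distr \<mu> borel (\<lambda>B. Q ** B) = \<mu>)"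

definition f_lin :: "real ^ 'd \<Rightarrow> real ^ 'd \<Rightarrow> real" where
  "f_lin g x = g \<bullet> x"

definition subspace_point :: "real ^ 'p ^ 'd \<Rightarrow> real ^ 'd \<Rightarrow> real ^ 'p \<Rightarrow> real ^ 'd" where
  "subspace_point B x z = x + (\<Sum>i\<in>UNIV. z $ i *\<^sub>R column i B)"

definition f_sub :: "(real ^ 'd \<Rightarrow> real) \<Rightarrow> real ^ 'p ^ 'd \<Rightarrow> real ^ 'd \<Rightarrow> real ^ 'p \<Rightarrow> real" where
  "f_sub f B x z = f (subspace_point B x z)"

definition simplex_gradient :: "(real ^ 'p \<Rightarrow> real) \<Rightarrow> real ^ 'p" where
  "simplex_gradient h = (\<chi> i. h (axis i 1) - h 0)"

definition mb_step :: "(real ^ 'p \<Rightarrow> real) \<Rightarrow> real ^ 'p" where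
  "mb_step h =
     (let s = simplex_gradient h; u = - (s /\<^sub>R norm s)
      in if s = 0 then 0 else arg_min_on h {0, u})"

definition mb_next :: "(real ^ 'd \<Rightarrow> real) \<Rightarrow> real ^ 'p ^ 'd \<Rightarrow> real ^ 'd \<Rightarrow> real ^ 'd" where
  "mb_next f B x = subspace_point B x (mb_step (f_sub f B x))"

text \<open>
  Expected decrease from the iterate \<open>x\<close> when \<open>g\<close> has law \<open>\<sigma>\<close> and \<open>B\<close> has law \<open>\<mu>\<close>; integrating
  against the product measure expresses the independence of \<open>g\<close> and \<open>B\<close>.
\<close>

definition E_mb :: "(real ^ 'd) measure \<Rightarrow> (real ^ 'p ^ 'd) measure \<Rightarrow> real ^ 'd \<Rightarrow> real" where
  "E_mb \<sigma> \<mu> x =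
     (\<integral>(g, B). f_lin g x - f_lin g (mb_next (f_lin g) B x) \<partial>(\<sigma> \<Otimes>\<^sub>M \<mu>))"

end

theory Submission
  imports Defs
begin

text \<open>
  The step of one iteration decreases $f^{lin}$ by exactly $\|B^T g\|$ (\<open>mb_decrease\<close>).  Invariance of
  the law of $B$ allows $g$ to be replaced by any fixed unit vector, and invariance of the law of
  $g$ allows $B$ to be replaced by any fixed orthonormal frame; so the expected decrease is
  $E\|A^T g\|$ for an arbitrary frame $A$ and an arbitrary uniform law of $g$
  (\<open>E_mb_eq_integral_directions\<close>).  In particular the two laws on the sphere may be taken to be the
  same one.

  Let $n = p + 1$, fix an $n$-frame $B$ and let $v = B^T g$.  Deleting the $k$-th column of $B$ leaves
  a $p$-frame, so that the two expectations to be compared are $E\|v\|$ and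
  $E\sqrt{\|v\|^2 - v_k^2}$, and the claim becomes
  $n\, E\|v\| < (n + 1)\, E\sqrt{\|v\|^2 - v_k^2}$ (\<open>norm_omit_integral_gt\<close>).
  The law of $v$ is invariant under all orthogonal $n \times n$ matrices, since any two frames are
  related by an orthogonal matrix acting from the left (\<open>stiefel_transitive\<close>,
  \<open>isotropic_coordinates\<close>).

  With $t = v_k^2 / \|v\|^2$, the square root is bounded from below by the cubic
  $\sqrt{1 - t} \ge 1 - t/2 - t^2/8 - 3t^3/8$.  This leaves the moments
  $m_k = E(\|v\| (a \cdot v / \|v\|)^k)$ of even order, which by invariance do not depend on the
  unit vector $a$.  Comparing coordinate vectors with $(e_i \pm e_j)/\sqrt 2$ yields
  $n m_2 = m_0$, $(n + 2) m_4 = 3 m_2$ and $(n + 4) m_6 = 5 m_4$, and the claim reduces to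
  $4n^3 + 17n^2 - 52n - 89 > 0$, which holds for $n \ge 3$.
\<close>

section \<open>Moments of isotropic measures\<close>

text \<open>
  The left-hand side equals $(1 - t)(1 + t/2 + 3t^2/8)$, and the second factor is a partial sum of
  the binomial series of $(1 - t)^{-1/2}$, whose terms are all nonnegative.
\<close>

lemma sqrt_one_minus_ge:
  fixes t :: real
  assumes "0 \<le> t" "t \<le> 1"
  shows "1 - t/2 - t\<^sup>2/8 - 3 * t^3/8 \<le> sqrt (1 - t)"
proof -
  define w where "w = 1 + t/2 + 3 * t\<^sup>2/8"
  have "1 - (1 - t) * w\<^sup>2 = t^3 * (40 + 15 * t + 9 * t\<^sup>2) / 64"
    unfolding w_def by (simp add: power2_eq_square power3_eq_cube) (simp add: field_simps)
  moreover have "\<dots> \<ge> 0"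
    using assms by simp
  ultimately have "(1 - t) * w\<^sup>2 \<le> 1"
    by linarith
  then have "(1 - t) * ((1 - t) * w\<^sup>2) \<le> (1 - t) * 1"
    using assms by (intro mult_left_mono) auto
  then have "((1 - t) * w)\<^sup>2 \<le> 1 - t"
    by (simp add: power2_eq_square algebra_simps)
  then have "(1 - t) * w \<le> sqrt (1 - t)"
    by (rule real_le_rsqrt)
  moreover have "(1 - t) * w = 1 - t/2 - t\<^sup>2/8 - 3 * t^3/8"
    unfolding w_def by (simp add: power2_eq_square power3_eq_cube) (simp add: field_simps)
  ultimately show ?thesis
    by simp
qed

text \<open>
  A Borel measure on $n$-space that is invariant under the orthogonal group and has a finite first
  absolute moment.
\<close>

locale isotropic_measure =
  fixes \<rho> :: "(real ^ 'n) measure"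
  assumes sets_eq_borel [measurable_cong]: "sets \<rho> = sets borel"
    and invariant: "orthogonal_matrix P \<Longrightarrow> distr \<rho> borel (\<lambda>v. P *v v) = \<rho>"
    and integrable_norm: "integrable \<rho> norm"
begin

text \<open>
  The $i$-th coordinate of the direction $v / \|v\|$; its value at the origin is $0$, and is
  immaterial because it always occurs with the factor $\|v\|$.
\<close>

definition dir :: "'n \<Rightarrow> real ^ 'n \<Rightarrow> real" where
  "dir i v = v $ i / norm v"

lemma dir_measurable [measurable]: "dir i \<in> borel_measurable borel"
  unfolding dir_def by simp

lemma abs_dir_le_1: "\<bar>dir i v\<bar> \<le> 1"
  using component_le_norm_cart[of v i] by (cases "v = 0") (auto simp: dir_def)

lemma norm_mult_sum_dir: "norm v * (\<Sum>i\<in>UNIV. (dir i v)\<^sup>2) = norm v"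
proof (cases "v = 0")
  case False
  have "(\<Sum>i\<in>UNIV. (v $ i)\<^sup>2) = (norm v)\<^sup>2"
    by (simp add: norm_vec_def L2_set_def sum_nonneg)
  then have "(\<Sum>i\<in>UNIV. (dir i v)\<^sup>2) = 1"
    using False by (simp add: dir_def power_divide flip: sum_divide_distrib)
  then show ?thesis
    by simp
qed simp

text \<open>
  Moments of the direction, weighted by $\|v\|$.
\<close>

definition mixed_moment :: "'n \<Rightarrow> 'n \<Rightarrow> nat \<Rightarrow> nat \<Rightarrow> real" where
  "mixed_moment i j a b = (\<integral>v. norm v * (dir i v ^ a * dir j v ^ b) \<partial>\<rho>)"

lemma integrable_norm_mult:
  assumes [measurable]: "f \<in> borel_measurable borel" and bound: "\<And>v. \<bar>f v\<bar> \<le> C"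
  shows "integrable \<rho> (\<lambda>v. norm v * f v)"
proof (rule Bochner_Integration.integrable_bound)
  show "integrable \<rho> (\<lambda>v. C * norm v)"
    using integrable_norm by simp
  show "AE v in \<rho>. norm (norm v * f v) \<le> norm (C * norm v)"
  proof (rule AE_I2)
    fix v
    have "\<bar>f v\<bar> \<le> \<bar>C\<bar>"
      using bound[of v] by simp
    then show "norm (norm v * f v) \<le> norm (C * norm v)"
      by (simp add: abs_mult mult.commute[of "\<bar>C\<bar>"] mult_left_mono)
  qed
qed simp

lemma integrable_mixed:
  "integrable \<rho> (\<lambda>v. norm v * (dir i v ^ a * dir j v ^ b))"
  by (rule integrable_norm_mult[where C = 1])
    (use abs_dir_le_1 in \<open>simp_all add: abs_mult power_abs power_le_one mult_le_one\<close>)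

lemmas integrable_single = integrable_mixed[where b = 0, simplified]

text \<open>
  By isotropy the joint law of $a \cdot v$ and $\|v\|$ is the same for all unit vectors $a$.
\<close>

lemma integral_direction_cong:
  fixes a b :: "real ^ 'n"
  assumes h: "(\<lambda>v. h (a \<bullet> v) (norm v)) \<in> borel_measurable borel"
    and "norm a = 1" "norm b = 1"
  shows "(\<integral>v. h (a \<bullet> v) (norm v) \<partial>\<rho>) = (\<integral>v. h (b \<bullet> v) (norm v) \<partial>\<rho> :: real)"
proof -
  obtain f where f: "orthogonal_transformation f" "f b = a"
    using orthogonal_transformation_exists[of b a] assms by auto
  define P where "P = matrix f"
  have P: "orthogonal_matrix P" and Pv: "P *v v = f v" for v
    using f(1) by (auto simp: P_def orthogonal_transformation_matrix matrix_works)
  have inner: "f u \<bullet> f v = u \<bullet> v" for u v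
    using f(1) by (simp add: orthogonal_transformation_def)
  have "(\<integral>v. h (a \<bullet> v) (norm v) \<partial>\<rho>) = (\<integral>v. h (a \<bullet> v) (norm v) \<partial>distr \<rho> borel (\<lambda>v. P *v v))"
    using invariant[OF P] by simp
  also have "\<dots> = (\<integral>v. h (a \<bullet> (P *v v)) (norm (P *v v)) \<partial>\<rho>)"
    using h by (intro integral_distr)
      (simp_all add: measurable_cong_sets[OF sets_eq_borel refl] borel_measurable_continuous_onI
        matrix_vector_mult_linear_continuous_on)
  also have "\<dots> = (\<integral>v. h (b \<bullet> v) (norm v) \<partial>\<rho>)"
    using f(1) by (simp add: Pv orthogonal_transformation_norm inner flip: f(2))
  finally show ?thesis .
qed

text \<open>
  The weighted moment in a single direction; all unit vectors give the same value, so that the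
  choice of the coordinate \<open>undefined\<close> is immaterial.
\<close>

definition moment :: "nat \<Rightarrow> real" where
  "moment k = (\<integral>v. norm v * dir undefined v ^ k \<partial>\<rho>)"

lemma integral_direction_power:
  fixes a :: "real ^ 'n"
  assumes "norm a = 1"
  shows "(\<integral>v. norm v * (a \<bullet> v / norm v) ^ k \<partial>\<rho>) = moment k"
  using integral_direction_cong[of "\<lambda>s r. r * (s / r) ^ k" a "axis undefined 1"] assms
  by (simp add: moment_def dir_def inner_axis norm_axis_1 inner_axis')

lemma integral_dir_power: "(\<integral>v. norm v * dir i v ^ k \<partial>\<rho>) = moment k"
  using integral_direction_power[of "axis i 1" k] by (simp add: dir_def inner_axis' norm_axis_1)

lemma moment_0: "moment 0 = (\<integral>v. norm v \<partial>\<rho>)"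
  by (simp add: moment_def)

lemma sum_mixed_moment: "(\<Sum>j\<in>UNIV. mixed_moment i j k 2) = moment k"
proof -
  have "(\<Sum>j\<in>UNIV. mixed_moment i j k 2)
      = (\<integral>v. (\<Sum>j\<in>UNIV. norm v * (dir i v ^ k * (dir j v)\<^sup>2)) \<partial>\<rho>)"
    unfolding mixed_moment_def by (simp add: integrable_mixed)
  also have "\<dots> = (\<integral>v. norm v * dir i v ^ k \<partial>\<rho>)"
  proof (intro Bochner_Integration.integral_cong refl)
    fix v
    have "(\<Sum>j\<in>UNIV. norm v * (dir i v ^ k * (dir j v)\<^sup>2))
        = dir i v ^ k * (norm v * (\<Sum>j\<in>UNIV. (dir j v)\<^sup>2))"
      by (simp add: sum_distrib_left algebra_simps)
    then show "(\<Sum>j\<in>UNIV. norm v * (dir i v ^ k * (dir j v)\<^sup>2)) = norm v * dir i v ^ k"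
      by (simp add: norm_mult_sum_dir)
  qed
  finally show ?thesis
    by (simp add: integral_dir_power)
qed

text \<open>
  The moments in the directions $(e_i + e_j)/\sqrt 2$ and $(e_i - e_j)/\sqrt 2$ are added up; for
  even $k$ the terms of odd degree in either coordinate then cancel.
\<close>

lemma rotated_moment:
  assumes "i \<noteq> j"
  shows "2 * sqrt 2 ^ k * moment k
       = (\<integral>v. norm v * ((dir i v + dir j v) ^ k + (dir i v - dir j v) ^ k) \<partial>\<rho>)"
proof -
  define a :: "real \<Rightarrow> real ^ 'n" where "a c = (1 / sqrt 2) *\<^sub>R (axis i 1 + c *\<^sub>R axis j 1)" for c
  have nrm: "norm (a c) = 1" if "\<bar>c\<bar> = 1" for c
  proof -
    have "c * c = 1"
      using that by (metis abs_mult_self_eq mult_1)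
    then have "a c \<bullet> a c = 1"
      using assms by (simp add: a_def inner_simps inner_axis_axis)
    then show ?thesis
      by (simp add: norm_eq_1)
  qed
  have a: "a c \<bullet> v / norm v = (dir i v + c * dir j v) / sqrt 2" for c v
    by (simp add: a_def inner_add_left inner_axis' dir_def add_divide_distrib mult.commute)
  have eq: "sqrt 2 ^ k * moment k = (\<integral>v. norm v * (dir i v + c * dir j v) ^ k \<partial>\<rho>)" if "\<bar>c\<bar> = 1" for c
    using integral_direction_power[OF nrm[OF that], of k] unfolding a
    by (simp add: power_divide divide_eq_eq mult.commute)
  have int: "integrable \<rho> (\<lambda>v. norm v * (dir i v + c * dir j v) ^ k)" if "\<bar>c\<bar> = 1" for c
  proof (rule integrable_norm_mult)
    fix v
    have "\<bar>dir i v + c * dir j v\<bar> \<le> \<bar>dir i v\<bar> + \<bar>c * dir j v\<bar>"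
      by (rule abs_triangle_ineq)
    also have "\<dots> \<le> 1 + 1"
      using abs_dir_le_1[of i v] abs_dir_le_1[of j v] that by (simp add: abs_mult)
    finally show "\<bar>(dir i v + c * dir j v) ^ k\<bar> \<le> 2 ^ k"
      by (simp add: power_abs power_mono)
  qed simp
  show ?thesis
    using eq[of 1] eq[of "-1"] int[of 1] int[of "-1"] by (simp add: algebra_simps)
qed

lemma mixed_moment_2_2:
  assumes "i \<noteq> j"
  shows "3 * mixed_moment i j 2 2 = moment 4"
proof -
  have expand: "norm v * ((x + y) ^ 4 + (x - y) ^ 4)
      = 2 * (norm v * x ^ 4) + 12 * (norm v * (x\<^sup>2 * y\<^sup>2)) + 2 * (norm v * y ^ 4)" for x y and v :: "real ^ 'n"
    by algebra
  have "sqrt 2 ^ 4 = (4 :: real)"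
    using power_mult[of "sqrt 2" 2 2] by simp
  then have "8 * moment 4 = 2 * moment 4 + 12 * mixed_moment i j 2 2 + 2 * moment 4"
    using rotated_moment[OF assms, of 4] unfolding expand
    by (simp add: integrable_mixed integrable_single integral_dir_power mixed_moment_def)
  then show ?thesis
    by simp
qed

lemma mixed_moment_4_2:
  assumes "i \<noteq> j"
  shows "5 * (mixed_moment i j 4 2 + mixed_moment j i 4 2) = 2 * moment 6"
proof -
  have expand: "norm v * ((x + y) ^ 6 + (x - y) ^ 6)
      = 2 * (norm v * x ^ 6) + 30 * (norm v * (x ^ 4 * y\<^sup>2)) + 30 * (norm v * (y ^ 4 * x\<^sup>2))
      + 2 * (norm v * y ^ 6)" for x y and v :: "real ^ 'n"
    by algebra
  have "sqrt 2 ^ 6 = (8 :: real)"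
    using power_mult[of "sqrt 2" 2 3] by simp
  then have "16 * moment 6 = 2 * moment 6 + 30 * mixed_moment i j 4 2 + 30 * mixed_moment j i 4 2 + 2 * moment 6"
    using rotated_moment[OF assms, of 6] unfolding expand
    by (simp add: integrable_mixed integrable_single integral_dir_power mixed_moment_def)
  then show ?thesis
    by simp
qed

lemma moment_2: "real CARD('n) * moment 2 = moment 0"
proof -
  have "mixed_moment i j 0 2 = moment 2" for i j
    by (simp add: mixed_moment_def integral_dir_power)
  then show ?thesis
    using sum_mixed_moment[of undefined 0] by simp
qed

lemma moment_4: "(real CARD('n) + 2) * moment 4 = 3 * moment 2"
proof -
  have "mixed_moment i i 2 2 = moment 4" for i
    by (simp add: mixed_moment_def integral_dir_power flip: power_add)
  then have "3 * mixed_moment i j 2 2 = moment 4 + (if j = i then 2 * moment 4 else 0)" for i j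
    using mixed_moment_2_2[of i j] by auto
  then have "3 * (\<Sum>j\<in>UNIV. mixed_moment i j 2 2) = (real CARD('n) + 2) * moment 4" for i
    by (simp add: sum_distrib_left sum.distrib algebra_simps)
  then show ?thesis
    by (simp add: sum_mixed_moment)
qed

lemma moment_6: "(real CARD('n) + 4) * moment 6 = 5 * moment 4"
proof -
  let ?n = "real CARD('n)"
  have "mixed_moment i i 4 2 = moment 6" for i
    by (simp add: mixed_moment_def integral_dir_power flip: power_add)
  then have *: "5 * (mixed_moment i j 4 2 + mixed_moment j i 4 2)
      = 2 * moment 6 + (if j = i then 8 * moment 6 else 0)" for i j
    using mixed_moment_4_2[of i j] by auto
  \<comment> \<open>The relation between mixed moments is symmetric in \<open>i\<close> and \<open>j\<close>, hence summed over both.\<close>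
  have "5 * (2 * (?n * moment 4))
      = 5 * ((\<Sum>i\<in>UNIV. \<Sum>j\<in>UNIV. mixed_moment i j 4 2) + (\<Sum>j\<in>UNIV. \<Sum>i\<in>UNIV. mixed_moment j i 4 2))"
    by (simp add: sum_mixed_moment)
  also have "\<dots> = 5 * ((\<Sum>i\<in>UNIV. \<Sum>j\<in>UNIV. mixed_moment i j 4 2) + (\<Sum>i\<in>UNIV. \<Sum>j\<in>UNIV. mixed_moment j i 4 2))"
    by (subst (2) sum.swap) (rule refl)
  also have "\<dots> = (\<Sum>i\<in>UNIV. \<Sum>j\<in>UNIV. 5 * (mixed_moment i j 4 2 + mixed_moment j i 4 2))"
    by (simp add: sum_distrib_left sum.distrib algebra_simps)
  also have "\<dots> = ?n * (2 * ((?n + 4) * moment 6))"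
    unfolding * by (simp add: sum.distrib algebra_simps)
  finally show ?thesis
    by simp
qed

text \<open>
  Deleting the coordinate $k$ from $v$ leaves a vector of norm $\sqrt{\|v\|^2 - v_k^2}$.
\<close>

lemma norm_omit_ge:
  "norm v - 1/2 * (norm v * (dir k v)\<^sup>2) - 1/8 * (norm v * dir k v ^ 4) - 3/8 * (norm v * dir k v ^ 6)
    \<le> sqrt ((norm v)\<^sup>2 - (v $ k)\<^sup>2)"
proof -
  have "1 - (dir k v)\<^sup>2 / 2 - (dir k v) ^ 4 / 8 - 3 * (dir k v) ^ 6 / 8 \<le> sqrt (1 - (dir k v)\<^sup>2)"
    using sqrt_one_minus_ge[of "(dir k v)\<^sup>2"] abs_dir_le_1[of k v]
    by (simp add: abs_square_le_1 flip: power_mult)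
  then have "norm v * (1 - (dir k v)\<^sup>2 / 2 - (dir k v) ^ 4 / 8 - 3 * (dir k v) ^ 6 / 8)
      \<le> norm v * sqrt (1 - (dir k v)\<^sup>2)"
    by (rule mult_left_mono) simp
  also have "\<dots> = sqrt ((norm v)\<^sup>2 * (1 - (dir k v)\<^sup>2))"
    by (simp add: real_sqrt_mult)
  also have "(norm v)\<^sup>2 * (1 - (dir k v)\<^sup>2) = (norm v)\<^sup>2 - (v $ k)\<^sup>2"
    by (cases "v = 0") (simp_all add: dir_def power_divide field_simps)
  finally show ?thesis
    by (simp add: algebra_simps)
qed

lemma sqrt_norm_omit_le_norm: "sqrt ((norm v)\<^sup>2 - (v $ k)\<^sup>2) \<le> norm v"
  by (rule real_le_lsqrt) auto

lemma norm_omit_integral_gt: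
  assumes n: "CARD('n) \<ge> 3" and pos: "(\<integral>v. norm v \<partial>\<rho>) > 0"
  shows "real CARD('n) * (\<integral>v. norm v \<partial>\<rho>)
       < (real CARD('n) + 1) * (\<integral>v. sqrt ((norm v)\<^sup>2 - (v $ k)\<^sup>2) \<partial>\<rho>)"
proof -
  define n where "n = real CARD('n)"
  have "n \<ge> 3"
    using n by (simp add: n_def)
  have int: "integrable \<rho> (\<lambda>v. sqrt ((norm v)\<^sup>2 - (v $ k)\<^sup>2))"
  proof (rule Bochner_Integration.integrable_bound[OF integrable_norm])
    have "(v $ k)\<^sup>2 \<le> (norm v)\<^sup>2" for v :: "real ^ 'n"
      using component_le_norm_cart[of v k] by (simp add: abs_le_square_iff[symmetric])
    then show "AE v in \<rho>. norm (sqrt ((norm v)\<^sup>2 - (v $ k)\<^sup>2)) \<le> norm (norm v)"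
      using sqrt_norm_omit_le_norm by (intro AE_I2) simp
  qed simp
  have "moment 0 - 1/2 * moment 2 - 1/8 * moment 4 - 3/8 * moment 6
      = (\<integral>v. norm v - 1/2 * (norm v * (dir k v)\<^sup>2) - 1/8 * (norm v * dir k v ^ 4)
             - 3/8 * (norm v * dir k v ^ 6) \<partial>\<rho>)"
    by (simp add: integrable_single integrable_norm integral_dir_power moment_0)
  also have "\<dots> \<le> (\<integral>v. sqrt ((norm v)\<^sup>2 - (v $ k)\<^sup>2) \<partial>\<rho>)"
    by (intro integral_mono int norm_omit_ge) (simp add: integrable_single integrable_norm)
  finally have le: "moment 0 - 1/2 * moment 2 - 1/8 * moment 4 - 3/8 * moment 6
      \<le> (\<integral>v. sqrt ((norm v)\<^sup>2 - (v $ k)\<^sup>2) \<partial>\<rho>)" .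
  \<comment> \<open>All the moments are polynomials in \<open>n\<close> times this constant.\<close>
  define c where "c = moment 6 / 15"
  have m6: "moment 6 = 15 * c"
    by (simp add: c_def)
  have m4: "moment 4 = 3 * (n + 4) * c"
    using moment_6 unfolding m6 n_def by linarith
  have "3 * moment 2 = 3 * ((n + 2) * (n + 4) * c)"
    using moment_4 unfolding m4 n_def by algebra
  then have m2: "moment 2 = (n + 2) * (n + 4) * c"
    by simp
  have m0: "moment 0 = n * (n + 2) * (n + 4) * c"
    using moment_2 unfolding m2 by (simp only: n_def mult.assoc)
  have "c > 0"
  proof (rule ccontr)
    assume "\<not> c > 0"
    then have "n * (n + 2) * (n + 4) * c \<le> 0"
      using \<open>n \<ge> 3\<close> by (intro mult_nonneg_nonpos) auto
    then show False
      using pos by (simp flip: m0 moment_0)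
  qed
  have "n * moment 0 < (n + 1) * (moment 0 - 1/2 * moment 2 - 1/8 * moment 4 - 3/8 * moment 6)"
  proof -
    \<comment> \<open>The cubic in \<open>n\<close> is expanded around 3, where all its coefficients are positive.\<close>
    have "8 * ((n + 1) * (moment 0 - 1/2 * moment 2 - 1/8 * moment 4 - 3/8 * moment 6) - n * moment 0)
      = c * (4 * (n - 3) ^ 3 + 53 * (n - 3)\<^sup>2 + 158 * (n - 3) + 16)"
      unfolding m0 m2 m4 m6 by algebra
    moreover have "\<dots> > 0"
      using \<open>c > 0\<close> \<open>n \<ge> 3\<close> by (intro mult_pos_pos add_nonneg_pos) auto
    ultimately show ?thesis
      by simp
  qed
  also have "\<dots> \<le> (n + 1) * (\<integral>v. sqrt ((norm v)\<^sup>2 - (v $ k)\<^sup>2) \<partial>\<rho>)"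
    using le \<open>n \<ge> 3\<close> by (intro mult_left_mono) auto
  finally show ?thesis
    by (simp add: n_def moment_0)
qed

end

section \<open>Orthonormal frames\<close>

text \<open>Products of the form $B^T g$ are kept, instead of being rewritten to $g$ times $B$.\<close>

declare transpose_matrix_vector [simp del]

lemma stiefel_iff_columns:
  fixes A :: "real ^ 'p ^ 'd"
  shows "A \<in> stiefel \<longleftrightarrow> (\<forall>i j. column i A \<bullet> column j A = (if i = j then 1 else 0))"
  by (auto simp: stiefel_def vec_eq_iff matrix_matrix_mult_def transpose_def mat_def column_def inner_vec_def)

lemma reflection_exists:
  fixes a b :: "'a :: real_inner"
  assumes "norm a = norm b"
  obtains f where "orthogonal_transformation f" "f a = b"
    "\<And>x. a \<bullet> x = 0 \<Longrightarrow> b \<bullet> x = 0 \<Longrightarrow> f x = x"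
proof (cases "a = b")
  case True
  then show ?thesis
    using that[of "\<lambda>x. x"] by simp
next
  case False
  \<comment> \<open>The reflection in the hyperplane orthogonal to \<open>a - b\<close>.\<close>
  define w where "w = a - b"
  define f where "f x = x - (2 * (w \<bullet> x) / (w \<bullet> w)) *\<^sub>R w" for x
  have w: "w \<bullet> w \<noteq> 0"
    using False by (simp add: w_def)
  have "a \<bullet> a = b \<bullet> b"
    using assms by (simp add: norm_eq)
  then have "2 * (w \<bullet> a) = w \<bullet> w"
    by (simp add: w_def inner_diff_left inner_diff_right inner_commute)
  then have "f a = b"
    using w by (simp add: f_def w_def)
  moreover have "orthogonal_transformation f"
    unfolding orthogonal_transformation_def
  proof (intro conjI allI)
    show "linear f"
      by (rule linearI) (simp_all add: f_def inner_add_right algebra_simps add_divide_distrib)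
    show "f x \<bullet> f y = x \<bullet> y" for x y
      using w by (simp add: f_def inner_diff_left inner_diff_right inner_commute field_simps)
  qed
  moreover have "f x = x" if "a \<bullet> x = 0" "b \<bullet> x = 0" for x
    using that by (simp add: f_def w_def inner_diff_left)
  ultimately show ?thesis
    using that by blast
qed

text \<open>
  The columns are mapped one at a time: the orthogonal map found for the columns in $S$ is composed
  with a reflection that corrects the image of the next column and fixes the columns already
  reached, to which both the image and its target are orthogonal.
\<close>

lemma stiefel_transitive:
  fixes A B :: "real ^ 'p ^ 'd"
  assumes "A \<in> stiefel" "B \<in> stiefel"
  obtains Q where "orthogonal_matrix Q" "Q ** A = B"
proof -
  have "\<exists>f. orthogonal_transformation f \<and> (\<forall>i\<in>S. f (column i A) = column i B)" for S :: "'p set"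
  proof (induction S rule: finite_induct[OF finite])
    case 1
    show ?case
      using orthogonal_transformation_id by blast
  next
    case (2 k S)
    then obtain f where f: "orthogonal_transformation f" "\<And>i. i \<in> S \<Longrightarrow> f (column i A) = column i B"
      by blast
    have A: "f (column i A) \<bullet> f (column j A) = (if i = j then 1 else 0)" for i j
      using assms(1) f(1) by (simp add: orthogonal_transformation_def stiefel_iff_columns)
    have B: "column i B \<bullet> column j B = (if i = j then 1 else 0)" for i j
      using assms(2) by (simp add: stiefel_iff_columns)
    have "norm (f (column k A)) = norm (column k B)"
      by (simp add: norm_eq A B)
    then obtain r where r: "orthogonal_transformation r" "r (f (column k A)) = column k B"
      "\<And>x. f (column k A) \<bullet> x = 0 \<Longrightarrow> column k B \<bullet> x = 0 \<Longrightarrow> r x = x"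
      using reflection_exists by metis
    have "r (f (column i A)) = column i B" if "i \<in> insert k S" for i
    proof (cases "i = k")
      case False
      with that have "i \<in> S"
        by simp
      with False show ?thesis
        using A[of k i] by (simp add: f(2) r(3) B)
    qed (simp add: r(2))
    then show ?case
      using orthogonal_transformation_compose[OF r(1) f(1)] by (intro exI[of _ "r \<circ> f"]) (simp add: o_def)
  qed
  then obtain f where f: "orthogonal_transformation f" "\<And>i. f (column i A) = column i B"
    by (metis UNIV_I)
  have "matrix f *v column i A = column i B" for i
    using f by (simp add: matrix_works orthogonal_transformation_linear)
  then have "matrix f ** A = B"
    by (simp add: vec_eq_iff matrix_matrix_mult_def matrix_vector_mult_def column_def)
  then show ?thesis
    using that f(1) orthogonal_transformation_matrix by blast
qed

lemma transpose_mult_component: "(transpose B *v g) $ i = column i B \<bullet> g" for B :: "real ^ 'p ^ 'd"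
  by (simp add: matrix_vector_mult_def transpose_def column_def inner_vec_def)

lemma norm_transpose_mult_le:
  fixes B :: "real ^ 'p ^ 'd"
  assumes "B \<in> stiefel"
  shows "norm (transpose B *v g) \<le> norm g"
proof -
  let ?v = "transpose B *v g"
  have "(norm ?v)\<^sup>2 = ?v \<bullet> (transpose B *v g)"
    by (simp add: dot_square_norm)
  also have "\<dots> = (B *v ?v) \<bullet> g"
    by (simp add: dot_lmul_matrix flip: vector_transpose_matrix)
  also have "\<dots> \<le> norm (B *v ?v) * norm g"
    by (rule norm_cauchy_schwarz)
  also have "norm (B *v ?v) = norm ?v"
  proof -
    have "(B *v ?v) \<bullet> (B *v ?v) = ?v \<bullet> (transpose B *v (B *v ?v))"
      by (simp add: dot_lmul_matrix flip: vector_transpose_matrix)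
    also have "transpose B *v (B *v ?v) = ?v"
      unfolding matrix_vector_mul_assoc[of "transpose B" B] using assms by (simp add: stiefel_def)
    finally show ?thesis
      by (simp add: norm_eq)
  qed
  finally show ?thesis
    by (cases "norm ?v = 0") (simp_all add: power2_eq_square)
qed

section \<open>The expected decrease\<close>

lemma borel_measurable_matrix_vector_mult [measurable]: "(\<lambda>g. M *v g) \<in> borel_measurable borel"
  for M :: "real ^ 'd ^ 'm"
  by (intro borel_measurable_continuous_onI continuous_intros)

text \<open>
  On the subspace the function is $z \mapsto g \cdot x + z \cdot s$ with $s = B^T g$ its simplex
  gradient, so that the step $-s/\|s\|$ decreases it by $\|s\|$.  This needs neither $g$ to be a
  unit vector nor $B$ to be orthonormal.
\<close>

lemma mb_decrease:
  fixes B :: "real ^ 'p ^ 'd"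
  shows "f_lin g x - f_lin g (mb_next (f_lin g) B x) = norm (transpose B *v g)"
proof -
  define s where "s = transpose B *v g"
  define h where "h = f_sub (f_lin g) B x"
  have h: "h z = g \<bullet> x + z \<bullet> s" for z
    by (simp add: h_def f_sub_def f_lin_def subspace_point_def s_def inner_add_right inner_sum_right
        inner_vec_def[of z] transpose_mult_component inner_commute)
  have grad: "simplex_gradient h = s"
    by (simp add: simplex_gradient_def h inner_axis' vec_eq_iff)
  have "h (mb_step h) = g \<bullet> x - norm s"
  proof (cases "s = 0")
    case False
    let ?u = "- (s /\<^sub>R norm s)"
    have u: "h ?u = g \<bullet> x - norm s"
      using False by (simp add: h dot_square_norm power2_eq_square)
    have "h (arg_min_on h {0, ?u}) = h ?u"
      unfolding arg_min_on_def using u by (intro arg_min_equality) (auto simp: h)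
    then show ?thesis
      using False u by (simp add: mb_step_def grad Let_def)
  qed (simp add: mb_step_def grad h)
  then show ?thesis
    by (simp add: mb_next_def f_lin_def h_def[symmetric] s_def[symmetric]) (simp add: h_def f_sub_def f_lin_def)
qed

lemma borel_measurable_transpose_mult [measurable]:
  "(\<lambda>(g, B). norm (transpose B *v g)) \<in> borel_measurable (borel \<Otimes>\<^sub>M (borel :: (real ^ 'p ^ 'd) measure))"
proof -
  have "continuous_on UNIV (\<lambda>x. norm (transpose (snd x :: real ^ 'p ^ 'd) *v fst x))"
    unfolding matrix_vector_mult_def transpose_def
    by (intro continuous_intros)
  then show ?thesis
    unfolding borel_prod by (intro borel_measurable_continuous_onI) (simp add: case_prod_unfold)
qed

lemma orthogonal_matrix_exists_mapping:
  fixes a b :: "real ^ 'n"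
  assumes "norm a = norm b"
  obtains Q where "orthogonal_matrix Q" "Q *v a = b"
proof -
  obtain f where f: "orthogonal_transformation f" "f a = b"
    using orthogonal_transformation_exists[OF assms] .
  then show ?thesis
    using that[of "matrix f"] by (simp add: orthogonal_transformation_matrix matrix_works)
qed

lemma integral_over_frames_cong:
  fixes \<mu> :: "(real ^ 'p ^ 'd) measure"
  assumes "uniform_on_stiefel \<mu>" "norm a = norm b"
  shows "(\<integral>B. norm (transpose B *v a) \<partial>\<mu>) = (\<integral>B. norm (transpose B *v b) \<partial>\<mu>)"
proof -
  obtain Q where Q: "orthogonal_matrix Q" "Q *v a = b"
    using orthogonal_matrix_exists_mapping[OF assms(2)] .
  have sets: "sets \<mu> = sets borel" and inv: "distr \<mu> borel (\<lambda>B. transpose Q ** B) = \<mu>"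
    using assms(1) Q(1) by (auto simp: uniform_on_stiefel_def)
  have "(\<integral>B. norm (transpose B *v a) \<partial>\<mu>) = (\<integral>B. norm (transpose B *v a) \<partial>distr \<mu> borel (\<lambda>B. transpose Q ** B))"
    by (simp add: inv)
  also have "\<dots> = (\<integral>B. norm (transpose (transpose Q ** B) *v a) \<partial>\<mu>)"
    unfolding measurable_cong_sets[OF sets refl]
    by (intro integral_distr) (auto simp: measurable_cong_sets[OF sets refl] matrix_matrix_mult_def
       matrix_vector_mult_def transpose_def intro!: borel_measurable_continuous_onI continuous_intros)
  also have "\<dots> = (\<integral>B. norm (transpose B *v b) \<partial>\<mu>)"
    by (simp add: matrix_transpose_mul Q(2) flip: matrix_vector_mul_assoc)
  finally show ?thesis .
qed

lemma integral_over_directions_cong: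
  fixes \<sigma> :: "(real ^ 'd) measure" and A B :: "real ^ 'p ^ 'd"
  assumes "uniform_on_sphere \<sigma>" "A \<in> stiefel" "B \<in> stiefel"
  shows "(\<integral>g. norm (transpose A *v g) \<partial>\<sigma>) = (\<integral>g. norm (transpose B *v g) \<partial>\<sigma>)"
proof -
  obtain Q where Q: "orthogonal_matrix Q" "Q ** A = B"
    using stiefel_transitive[OF assms(2,3)] .
  have sets: "sets \<sigma> = sets borel" and inv: "distr \<sigma> borel (\<lambda>g. transpose Q *v g) = \<sigma>"
    using assms(1) Q(1) by (auto simp: uniform_on_sphere_def)
  have "(\<integral>g. norm (transpose A *v g) \<partial>\<sigma>) = (\<integral>g. norm (transpose A *v g) \<partial>distr \<sigma> borel (\<lambda>g. transpose Q *v g))"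
    by (simp add: inv)
  also have "\<dots> = (\<integral>g. norm (transpose A *v (transpose Q *v g)) \<partial>\<sigma>)"
    by (intro integral_distr) (auto simp: measurable_cong_sets[OF sets refl]
        intro!: borel_measurable_continuous_onI continuous_intros)
  also have "\<dots> = (\<integral>g. norm (transpose B *v g) \<partial>\<sigma>)"
    by (simp add: matrix_vector_mul_assoc Q(2) flip: matrix_transpose_mul)
  finally show ?thesis .
qed

lemma integrable_decrease:
  fixes \<sigma> :: "(real ^ 'd) measure" and \<mu> :: "(real ^ 'p ^ 'd) measure"
  assumes "uniform_on_sphere \<sigma>" "uniform_on_stiefel \<mu>"
  shows "integrable (\<sigma> \<Otimes>\<^sub>M \<mu>) (\<lambda>(g, B). norm (transpose B *v g))"
proof -
  interpret \<sigma>: prob_space \<sigma> using assms(1) by (simp add: uniform_on_sphere_def)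
  interpret \<mu>: prob_space \<mu> using assms(2) by (simp add: uniform_on_stiefel_def)
  interpret pair_prob_space \<sigma> \<mu> ..
  have sets [measurable_cong]: "sets \<sigma> = sets borel" "sets \<mu> = sets borel"
    using assms by (auto simp: uniform_on_sphere_def uniform_on_stiefel_def)
  have meas: "(\<lambda>(g, B). norm (transpose B *v g)) \<in> borel_measurable (\<sigma> \<Otimes>\<^sub>M \<mu>)"
    using borel_measurable_transpose_mult
    by (simp add: measurable_cong_sets[OF sets_pair_measure_cong[OF sets] refl])
  have le: "norm (norm (transpose B *v g)) \<le> 1" if "B \<in> stiefel" "g \<in> sphere 0 1"
    for g :: "real ^ 'd" and B :: "real ^ 'p ^ 'd"
    using norm_transpose_mult_le[OF that(1), of g] that(2) by simp
  have "AE g in \<sigma>. AE B in \<mu>. norm (norm (transpose B *v g)) \<le> 1"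
  proof -
    have "AE g in \<sigma>. g \<in> sphere 0 1" "AE B in \<mu>. B \<in> stiefel"
      using assms by (simp_all add: uniform_on_sphere_def uniform_on_stiefel_def)
    then show ?thesis
      using le by (auto elim!: eventually_mono)
  qed
  then have "AE z in \<sigma> \<Otimes>\<^sub>M \<mu>. norm (case z of (g, B) \<Rightarrow> norm (transpose B *v g)) \<le> 1"
    using meas by (intro AE_pair_measure) (simp_all add: case_prod_unfold)
  then show ?thesis
    using meas by (rule P.integrable_const_bound)
qed

lemma E_mb_eq_integral_frames:
  fixes \<sigma> :: "(real ^ 'd) measure" and \<mu> :: "(real ^ 'p ^ 'd) measure"
  assumes "uniform_on_sphere \<sigma>" "uniform_on_stiefel \<mu>" "norm a = 1"
  shows "E_mb \<sigma> \<mu> x = (\<integral>B. norm (transpose B *v a) \<partial>\<mu>)"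
proof -
  interpret \<sigma>: prob_space \<sigma> using assms(1) by (simp add: uniform_on_sphere_def)
  interpret \<mu>: prob_space \<mu> using assms(2) by (simp add: uniform_on_stiefel_def)
  interpret pair_prob_space \<sigma> \<mu> ..
  have "E_mb \<sigma> \<mu> x = (\<integral>g. (\<integral>B. norm (transpose B *v g) \<partial>\<mu>) \<partial>\<sigma>)"
    using integral_fst[OF integrable_decrease[OF assms(1,2)]] by (simp add: E_mb_def mb_decrease)
  also have "\<dots> = (\<integral>g. (\<integral>B. norm (transpose B *v a) \<partial>\<mu>) \<partial>\<sigma>)"
  proof (rule integral_cong_AE)
    show "(\<lambda>g. \<integral>B. norm (transpose B *v g) \<partial>\<mu>) \<in> borel_measurable \<sigma>"
      using integrable_fst[OF integrable_decrease[OF assms(1,2)]] by simp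
    have "AE g in \<sigma>. g \<in> sphere 0 1"
      using assms(1) by (simp add: uniform_on_sphere_def)
    then show "AE g in \<sigma>. (\<integral>B. norm (transpose B *v g) \<partial>\<mu>) = (\<integral>B. norm (transpose B *v a) \<partial>\<mu>)"
      by (rule AE_mp) (use assms(3) in \<open>auto intro!: AE_I2 integral_over_frames_cong assms(2)\<close>)
  qed simp
  finally show ?thesis
    by (simp add: \<sigma>.prob_space)
qed

text \<open>
  Since the average over $B$ for a fixed unit vector does not involve the law of $g$, that law may be
  replaced by any other uniform law before averaging over $g$ for a fixed frame.
\<close>

lemma E_mb_eq_integral_directions:
  fixes \<sigma> \<tau> :: "(real ^ 'd) measure" and \<mu> :: "(real ^ 'p ^ 'd) measure" and A :: "real ^ 'p ^ 'd"
  assumes "uniform_on_sphere \<sigma>" "uniform_on_sphere \<tau>" "uniform_on_stiefel \<mu>" "A \<in> stiefel"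
  shows "E_mb \<sigma> \<mu> x = (\<integral>g. norm (transpose A *v g) \<partial>\<tau>)"
proof -
  interpret \<tau>: prob_space \<tau> using assms(2) by (simp add: uniform_on_sphere_def)
  interpret \<mu>: prob_space \<mu> using assms(3) by (simp add: uniform_on_stiefel_def)
  interpret pair_prob_space \<tau> \<mu> ..
  have "E_mb \<sigma> \<mu> x = E_mb \<tau> \<mu> x"
    using E_mb_eq_integral_frames[OF assms(1,3), of "axis undefined 1"]
      E_mb_eq_integral_frames[OF assms(2,3), of "axis undefined 1"] by (simp add: norm_axis_1)
  also have "\<dots> = (\<integral>B. (\<integral>g. norm (transpose B *v g) \<partial>\<tau>) \<partial>\<mu>)"
    using integral_snd[OF integrable_decrease[OF assms(2,3)]] by (simp add: E_mb_def mb_decrease)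
  also have "\<dots> = (\<integral>B. (\<integral>g. norm (transpose A *v g) \<partial>\<tau>) \<partial>\<mu>)"
  proof (rule integral_cong_AE)
    show "(\<lambda>B. \<integral>g. norm (transpose B *v g) \<partial>\<tau>) \<in> borel_measurable \<mu>"
      using integrable_snd[OF integrable_decrease[OF assms(2,3)]] by simp
    have "AE B in \<mu>. B \<in> stiefel"
      using assms(3) by (simp add: uniform_on_stiefel_def)
    then show "AE B in \<mu>. (\<integral>g. norm (transpose B *v g) \<partial>\<tau>) = (\<integral>g. norm (transpose A *v g) \<partial>\<tau>)"
      by (rule eventually_mono) (rule integral_over_directions_cong[OF assms(2) _ assms(4)])
  qed simp
  finally show ?thesis
    by (simp add: \<mu>.prob_space)
qed

text \<open>
  If $P$ is an orthogonal matrix, then $B P^T$ is again a frame, hence of the form $Q B$ with $Q$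
  orthogonal; so $P B^T g = B^T Q^T g$, which has the same law as $B^T g$.
\<close>

lemma isotropic_coordinates:
  fixes \<tau> :: "(real ^ 'd) measure" and B :: "real ^ 'q ^ 'd"
  assumes \<tau>: "uniform_on_sphere \<tau>" and B: "B \<in> stiefel"
  defines "\<rho> \<equiv> distr \<tau> borel (\<lambda>g. transpose B *v g)"
  shows "isotropic_measure \<rho>" "(\<integral>v. norm v \<partial>\<rho>) > 0"
proof -
  interpret \<tau>: prob_space \<tau> using \<tau> by (simp add: uniform_on_sphere_def)
  have sets [measurable_cong]: "sets \<tau> = sets borel" and unit: "AE g in \<tau>. g \<in> sphere 0 1"
    and inv: "\<And>Q. orthogonal_matrix Q \<Longrightarrow> distr \<tau> borel (\<lambda>g. Q *v g) = \<tau>"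
    using \<tau> by (auto simp: uniform_on_sphere_def)
  have int: "integrable \<tau> (\<lambda>g. norm (transpose B *v g))"
  proof (rule \<tau>.integrable_const_bound[where B = 1])
    show "AE g in \<tau>. norm (norm (transpose B *v g)) \<le> 1"
      using unit
    proof (rule eventually_mono)
      show "norm (norm (transpose B *v g)) \<le> 1" if "g \<in> sphere 0 1" for g
        using norm_transpose_mult_le[OF B, of g] that by simp
    qed
  qed measurable
  show "isotropic_measure \<rho>"
  proof
    show "sets \<rho> = sets borel"
      by (simp add: \<rho>_def)
    show "integrable \<rho> norm"
      unfolding \<rho>_def using int by (subst integrable_distr_eq) simp_all
    fix P :: "real ^ 'q ^ 'q"
    assume P: "orthogonal_matrix P"
    have "B ** transpose P \<in> stiefel"
    proof -
      have "transpose (B ** transpose P) ** (B ** transpose P) = P ** (transpose B ** B) ** transpose P"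
        by (simp add: matrix_transpose_mul matrix_mul_assoc)
      then show ?thesis
        using B P by (simp add: stiefel_def orthogonal_matrix_def)
    qed
    then obtain Q where Q: "orthogonal_matrix Q" "Q ** B = B ** transpose P"
      using stiefel_transitive[OF B] by blast
    have eq: "P *v (transpose B *v g) = transpose B *v (transpose Q *v g)" for g
    proof -
      have "P ** transpose B = transpose (B ** transpose P)"
        by (simp add: matrix_transpose_mul)
      also have "\<dots> = transpose B ** transpose Q"
        by (simp add: matrix_transpose_mul flip: Q(2))
      finally show ?thesis
        by (simp add: matrix_vector_mul_assoc)
    qed
    have "distr \<rho> borel (\<lambda>v. P *v v) = distr \<tau> borel (\<lambda>g. P *v (transpose B *v g))"
      unfolding \<rho>_def
      by (subst distr_distr) (simp_all add: o_def)
    also have "\<dots> = distr (distr \<tau> borel (\<lambda>g. transpose Q *v g)) borel (\<lambda>g. transpose B *v g)"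
      unfolding eq by (subst distr_distr) (simp_all add: o_def)
    also have "\<dots> = \<rho>"
      using Q(1) by (simp add: inv \<rho>_def)
    finally show "distr \<rho> borel (\<lambda>v. P *v v) = \<rho>" .
  qed
  have "(\<integral>v. norm v \<partial>\<rho>) = (\<integral>g. norm (transpose B *v g) \<partial>\<tau>)"
    unfolding \<rho>_def by (rule integral_distr) simp_all
  also have "\<dots> > 0"
  proof (rule ccontr)
    \<comment> \<open>Otherwise \<open>g\<close> would be orthogonal to one column of \<open>B\<close>, hence by invariance to every
      coordinate vector, almost surely.\<close>
    assume "\<not> (\<integral>g. norm (transpose B *v g) \<partial>\<tau>) > 0"
    then have "(\<integral>g. norm (transpose B *v g) \<partial>\<tau>) = 0"
      by (meson Bochner_Integration.integral_nonneg norm_ge_zero not_less order_antisym)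
    then have zero: "AE g in \<tau>. transpose B *v g = 0"
      using int by (simp add: integral_nonneg_eq_0_iff_AE)
    have "AE g in \<tau>. g $ i = 0" for i
    proof -
      define b where "b = column undefined B"
      have "b \<bullet> b = 1"
        using B by (simp add: b_def stiefel_iff_columns)
      then have "norm (axis i 1 :: real ^ 'd) = norm b"
        by (simp add: norm_eq_1 norm_axis_1)
      then obtain Q where Q: "orthogonal_matrix Q" "Q *v axis i 1 = b"
        using orthogonal_matrix_exists_mapping by blast
      have "AE g in \<tau>. b \<bullet> g = 0"
        using zero by (rule AE_mp) (auto intro!: AE_I2 simp: b_def simp flip: transpose_mult_component)
      then have "AE g in distr \<tau> borel (\<lambda>g. Q *v g). b \<bullet> g = 0"
        by (simp only: inv[OF Q(1)])
      then have "AE g in \<tau>. b \<bullet> (Q *v g) = 0"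
        by (subst (asm) AE_distr_iff) simp_all
      moreover have "b \<bullet> (Q *v g) = g $ i" for g
      proof -
        have "orthogonal_transformation ((*v) Q)"
          using Q(1) by (simp add: orthogonal_transformation_matrix)
        then show ?thesis
          by (simp add: orthogonal_transformation_def inner_axis' flip: Q(2))
      qed
      ultimately show ?thesis
        by simp
    qed
    then have "AE g in \<tau>. g = 0"
      by (simp add: vec_eq_iff AE_all_countable)
    with unit have "AE g in \<tau>. False"
      by eventually_elim auto
    then show False
      by simp
  qed
  finally show "(\<integral>v. norm v \<partial>\<rho>) > 0" .
qed

theorem theorem4p5:
  fixes \<sigma> \<tau> :: "(real ^ 'd) measure"
    and \<mu> :: "(real ^ 'p ^ 'd) measure"
    and \<nu> :: "(real ^ 'q ^ 'd) measure"
    and x y :: "real ^ 'd"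
  assumes "CARD('d) > 2"
    and "2 \<le> CARD('p)" and "CARD('p) \<le> CARD('d) - 1"
    and "CARD('q) = CARD('p) + 1"
    and "uniform_on_sphere \<sigma>" and "uniform_on_stiefel \<mu>"
    and "uniform_on_sphere \<tau>" and "uniform_on_stiefel \<nu>"
  shows "E_mb \<sigma> \<mu> x / real (CARD('p) + 1) > E_mb \<tau> \<nu> y / real (CARD('p) + 2)"
proof -
  interpret \<nu>: prob_space \<nu>
    using assms(8) by (simp add: uniform_on_stiefel_def)
  have "AE B in \<nu>. B \<in> stiefel"
    using assms(8) by (simp add: uniform_on_stiefel_def)
  then obtain B :: "real ^ 'q ^ 'd" where B: "B \<in> stiefel"
    using \<nu>.AE_contr by blast
  define k :: 'q where "k = undefined"
  have "card (UNIV :: 'p set) = card (UNIV - {k})"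
    using assms(4) by (simp add: card_Diff_singleton)
  then obtain \<phi> where \<phi>: "bij_betw \<phi> (UNIV :: 'p set) (UNIV - {k})"
    by (metis finite finite_same_card_bij)
  \<comment> \<open>The frame \<open>B\<close> without its column \<open>k\<close>.\<close>
  define A :: "real ^ 'p ^ 'd" where "A = (\<chi> r i. B $ r $ \<phi> i)"
  have col: "column i A = column (\<phi> i) B" for i
    by (simp add: A_def column_def vec_eq_iff)
  have A: "A \<in> stiefel"
    using B \<phi> by (auto simp: stiefel_iff_columns col bij_betw_def inj_on_def)
  define \<rho> where "\<rho> = distr \<tau> borel (\<lambda>g. transpose B *v g)"
  interpret isotropic_measure \<rho>
    unfolding \<rho>_def by (rule isotropic_coordinates(1)[OF assms(7) B])
  have [measurable_cong]: "sets \<tau> = sets borel"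
    using assms(7) by (simp add: uniform_on_sphere_def)
  have q: "E_mb \<tau> \<nu> y = (\<integral>v. norm v \<partial>\<rho>)"
    unfolding \<rho>_def E_mb_eq_integral_directions[OF assms(7,7,8) B]
    by (rule integral_distr[symmetric]) simp_all
  have "norm (transpose A *v g) = sqrt ((norm (transpose B *v g))\<^sup>2 - ((transpose B *v g) $ k)\<^sup>2)" for g
  proof -
    let ?v = "transpose B *v g"
    have "(norm (transpose A *v g))\<^sup>2 = (\<Sum>i\<in>UNIV. (?v $ \<phi> i)\<^sup>2)"
      by (simp add: norm_vec_def L2_set_def sum_nonneg transpose_mult_component col)
    also have "\<dots> = (\<Sum>j\<in>UNIV - {k}. (?v $ j)\<^sup>2)"
      by (rule sum.reindex_bij_betw[OF \<phi>])
    also have "\<dots> = (\<Sum>j\<in>UNIV. (?v $ j)\<^sup>2) - (?v $ k)\<^sup>2"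
      by (simp add: sum_diff1)
    also have "(\<Sum>j\<in>UNIV. (?v $ j)\<^sup>2) = (norm ?v)\<^sup>2"
      by (simp add: norm_vec_def L2_set_def sum_nonneg)
    finally show ?thesis
      by (metis norm_ge_zero real_sqrt_unique)
  qed
  then have p: "E_mb \<sigma> \<mu> x = (\<integral>v. sqrt ((norm v)\<^sup>2 - (v $ k)\<^sup>2) \<partial>\<rho>)"
    unfolding \<rho>_def E_mb_eq_integral_directions[OF assms(5,7,6) A]
    by (subst integral_distr) simp_all
  have "(real CARD('p) + 1) * E_mb \<tau> \<nu> y < (real CARD('p) + 2) * E_mb \<sigma> \<mu> x"
    using norm_omit_integral_gt[of k] isotropic_coordinates(2)[OF assms(7) B] assms(2)
    unfolding p q assms(4) \<rho>_def[symmetric] by (simp add: add.commute)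
  then have "E_mb \<tau> \<nu> y < E_mb \<sigma> \<mu> x * (real CARD('p) + 2) / (real CARD('p) + 1)"
    by (intro mult_imp_less_div_pos) (simp_all add: mult.commute)
  then have "E_mb \<tau> \<nu> y < E_mb \<sigma> \<mu> x / real (CARD('p) + 1) * real (CARD('p) + 2)"
    by (simp add: add.commute)
  then show ?thesis
    by (intro mult_imp_div_pos_less) simp_all
qed

end
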